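(* Suppose that for each $n\in\mathbb N$ a group $G_n$ is equipped with two bi-invariant norms $\|\cdot\|_n$ and $\|\cdot\|'_n$, both bounded by $1$. Let $\mathcal G=(G_n,\|\cdot\|_n)_{n\in\mathbb N}$ and $\mathcal G'=(G_n,\|\cdot\|'_n)_{n\in\mathbb N}$, and let $\mathcal U$ be a non-principal ultrafilter on $\mathbb N$. If the family $\mathcal G$ is metrically uniformly simple and the metric ultraproduct $\mathcal G'^*_{\mathrm{met}}$ is simple, then $\mathcal G'^*_{\mathrm{met}}$ is metrically uniformly simple.
   Context: A bi-invariant norm on a group satisfies $\|e\|=0$, $\|gh\|\le\|g\|+\|h\|$, $\|g^{-1}\|=\|g\|=\|hgh^{-1}\|$, and $\|g\|=0$ iff $g=e$. The metric ultraproduct of a family $(G_n,\|\cdot\|_n)_n$ is $\prod_{n}G_n/\mathcal E$, $\mathcal E=\{(g_n) : \lim_{n\to\mathcal U}\|g_n\|_n=0\}$, with norm $\|(g_n)/\mathcal E\|=\lim_{n\to\mathcal U}\|g_n\|_n$. $C_N(g,G)$ is the set of all products of at most $N$ conjugates (in $G$) of $g$ and $g^{-1}$; $B_t(e)$ is the open ball of radius $t$ around $e$. A single group with norm $(G,\|\cdot\|)$ is metrically uniformly simple if for all $t>r>0$ there is $N\in\mathbb N$ such that $C_N(g,G)\supseteq B_t(e)$ for all $g\in G$ with $\|g\|\in(r,t]$. A family $(G_n,\|\cdot\|_n)_{n\in\mathbb N}$ is metrically uniformly simple if for all $t>r>0$ there is $N\in\mathbb N$ such that for all $n\in\mathbb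 N$ and all $g\in G_n$ with $\|g\|_n\in(r,t]$, $C_N(g,G_n)\supseteq B_t(e)$ holds in $G_n$. *)

theory Defs
  imports Complex_Main "HOL-Algebra.Product_Groups"
begin

section \<open>Bi-invariant norms and metric uniform simplicity\<close>

definition bi_invariant_norm :: "('a, 'b) monoid_scheme \<Rightarrow> ('a \<Rightarrow> real) \<Rightarrow> bool" where
  "bi_invariant_norm G \<nu> \<longleftrightarrow>
     \<nu> \<one>\<^bsub>G\<^esub> = 0 \<and>
     (\<forall>g\<in>carrier G. \<forall>h\<in>carrier G. \<nu> (g \<otimes>\<^bsub>G\<^esub> h) \<le> \<nu> g + \<nu> h) \<and>
     (\<forall>g\<in>carrier G. \<nu> (inv\<^bsub>G\<^esub> g) = \<nu> g) \<and>
     (\<forall>g\<in>carrier G. \<forall>h\<in>carrier G. \<nu> (h \<otimes>\<^bsub>G\<^esub> g \<otimes>\<^bsub>G\<^esub> inv\<^bsub>G\<^esub> h) = \<nu> g) \<and>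
     (\<forall>g\<in>carrier G. \<nu> g = 0 \<longleftrightarrow> g = \<one>\<^bsub>G\<^esub>)"

definition conj_class_sym :: "('a, 'b) monoid_scheme \<Rightarrow> 'a \<Rightarrow> 'a set" where
  "conj_class_sym G g =
     {h \<otimes>\<^bsub>G\<^esub> x \<otimes>\<^bsub>G\<^esub> inv\<^bsub>G\<^esub> h | h x. h \<in> carrier G \<and> x \<in> {g, inv\<^bsub>G\<^esub> g}}"

text \<open>The set \<open>C\<^sub>N(g, G)\<close>; the empty product \<open>\<one>\<close> is included.\<close>

definition conj_products :: "nat \<Rightarrow> 'a \<Rightarrow> ('a, 'b) monoid_scheme \<Rightarrow> 'a set" where
  "conj_products N g G =
     {foldr (\<otimes>\<^bsub>G\<^esub>) xs \<one>\<^bsub>G\<^esub> | xs. length xs \<le> N \<and> set xs \<subseteq> conj_class_sym G g}"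

definition norm_ball :: "('a, 'b) monoid_scheme \<Rightarrow> ('a \<Rightarrow> real) \<Rightarrow> real \<Rightarrow> 'a set" where
  "norm_ball G \<nu> t = {h \<in> carrier G. \<nu> h < t}"

definition metrically_uniformly_simple ::
    "('a, 'b) monoid_scheme \<Rightarrow> ('a \<Rightarrow> real) \<Rightarrow> bool" where
  "metrically_uniformly_simple G \<nu> \<longleftrightarrow>
     (\<forall>t r. t > r \<and> r > 0 \<longrightarrow>
        (\<exists>N. \<forall>g\<in>carrier G. \<nu> g \<in> {r<..t} \<longrightarrow> norm_ball G \<nu> t \<subseteq> conj_products N g G))"

definition metrically_uniformly_simple_family ::
    "('i \<Rightarrow> ('a, 'b) monoid_scheme) \<Rightarrow> ('i \<Rightarrow> 'a \<Rightarrow> real) \<Rightarrow> bool" where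
  "metrically_uniformly_simple_family G \<nu> \<longleftrightarrow>
     (\<forall>t r. t > r \<and> r > 0 \<longrightarrow>
        (\<exists>N. \<forall>n. \<forall>g\<in>carrier (G n). \<nu> n g \<in> {r<..t} \<longrightarrow>
           norm_ball (G n) (\<nu> n) t \<subseteq> conj_products N g (G n)))"

text \<open>
  The library locale \<open>simple_group\<close> requires \<open>order G > 1\<close>, where \<open>order G\<close> is a \<open>card\<close>
  and hence \<open>0\<close> for an infinite group, so it only covers finite simple groups.
\<close>

definition abstractly_simple :: "('a, 'b) monoid_scheme \<Rightarrow> bool" where
  "abstractly_simple G \<longleftrightarrow>
     group G \<and> carrier G \<noteq> {\<one>\<^bsub>G\<^esub>} \<and> (\<forall>H. H \<lhd> G \<longrightarrow> H = carrier G \<or> H = {\<one>\<^bsub>G\<^esub>})"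

section \<open>Ultrafilters and metric ultraproducts\<close>

definition ultrafilter :: "'i filter \<Rightarrow> bool" where
  "ultrafilter F \<longleftrightarrow> F \<noteq> bot \<and> (\<forall>P. eventually P F \<or> eventually (\<lambda>x. \<not> P x) F)"

definition non_principal :: "'i filter \<Rightarrow> bool" where
  "non_principal F \<longleftrightarrow> (\<forall>x. F \<noteq> principal {x})"

definition null_sequences ::
    "'i filter \<Rightarrow> ('i \<Rightarrow> ('a, 'b) monoid_scheme) \<Rightarrow> ('i \<Rightarrow> 'a \<Rightarrow> real) \<Rightarrow> ('i \<Rightarrow> 'a) set" where
  "null_sequences U G \<nu> =
     {g \<in> carrier (product_group UNIV G). ((\<lambda>n. \<nu> n (g n)) \<longlongrightarrow> 0) U}"

definition metric_ultraproduct ::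
    "'i filter \<Rightarrow> ('i \<Rightarrow> ('a, 'b) monoid_scheme) \<Rightarrow> ('i \<Rightarrow> 'a \<Rightarrow> real) \<Rightarrow> ('i \<Rightarrow> 'a) set monoid" where
  "metric_ultraproduct U G \<nu> = product_group UNIV G Mod null_sequences U G \<nu>"

text \<open>
  Elements of the ultraproduct are cosets \<open>X\<close>. For uniformly bounded norms the limit exists
  and does not depend on the representative \<open>g \<in> X\<close>; see \<open>ultraproduct_norm_coset\<close>.
\<close>

definition ultraproduct_norm ::
    "'i filter \<Rightarrow> ('i \<Rightarrow> 'a \<Rightarrow> real) \<Rightarrow> ('i \<Rightarrow> 'a) set \<Rightarrow> real" where
  "ultraproduct_norm U \<nu> X = (THE l. \<exists>g\<in>X. ((\<lambda>n. \<nu> n (g n)) \<longlongrightarrow> l) U)"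

section \<open>The metric ultraproduct is a group with a bi-invariant norm\<close>

lemma bi_invariant_normD:
  assumes "bi_invariant_norm G \<nu>"
  shows "\<nu> \<one>\<^bsub>G\<^esub> = 0"
    and "\<And>g h. g \<in> carrier G \<Longrightarrow> h \<in> carrier G \<Longrightarrow> \<nu> (g \<otimes>\<^bsub>G\<^esub> h) \<le> \<nu> g + \<nu> h"
    and "\<And>g. g \<in> carrier G \<Longrightarrow> \<nu> (inv\<^bsub>G\<^esub> g) = \<nu> g"
    and "\<And>g h. g \<in> carrier G \<Longrightarrow> h \<in> carrier G \<Longrightarrow> \<nu> (h \<otimes>\<^bsub>G\<^esub> g \<otimes>\<^bsub>G\<^esub> inv\<^bsub>G\<^esub> h) = \<nu> g"
    and "\<And>g. g \<in> carrier G \<Longrightarrow> \<nu> g = 0 \<longleftrightarrow> g = \<one>\<^bsub>G\<^esub>"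
  using assms by (auto simp: bi_invariant_norm_def)

lemma bi_invariant_norm_nonneg:
  assumes "group G" "bi_invariant_norm G \<nu>" "g \<in> carrier G"
  shows "\<nu> g \<ge> 0"
proof -
  interpret group G by fact
  note N = bi_invariant_normD[OF assms(2)]
  have "\<nu> (g \<otimes>\<^bsub>G\<^esub> inv\<^bsub>G\<^esub> g) \<le> \<nu> g + \<nu> (inv\<^bsub>G\<^esub> g)"
    using N(2) assms(3) by blast
  then show ?thesis
    using N(1) N(3)[OF assms(3)] assms(3) by simp
qed

lemma ultrafilter_limit_exists:
  fixes f :: "'i \<Rightarrow> real"
  assumes "ultrafilter U" "\<And>i. f i \<in> {a..b}"
  obtains l where "l \<in> {a..b}" "(f \<longlongrightarrow> l) U"
proof -
  have U: "U \<noteq> bot" "\<And>P. \<not> eventually P U \<Longrightarrow> eventually (\<lambda>x. \<not> P x) U"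
    using assms(1) by (auto simp: ultrafilter_def)
  define A where "A = {x. \<forall>\<^sub>F i in U. x \<le> f i}"
  have A: "x \<le> b" if "x \<in> A" for x
  proof -
    have "\<forall>\<^sub>F i in U. x \<le> b"
      using that unfolding A_def mem_Collect_eq
      by (rule eventually_mono) (use assms(2) in \<open>auto intro: order_trans\<close>)
    then show ?thesis using U(1) by (simp add: eventually_const)
  qed
  have aA: "a \<in> A" using assms(2) by (simp add: A_def)
  have bdd: "bdd_above A" using A by (rule bdd_aboveI)
  have "(f \<longlongrightarrow> Sup A) U"
  proof (rule order_tendstoI)
    fix y assume "y < Sup A"
    then obtain x where "x \<in> A" "y < x"
      using aA bdd less_cSup_iff[of A y] by blast
    then show "\<forall>\<^sub>F i in U. y < f i"
      unfolding A_def mem_Collect_eq by (auto elim: eventually_mono)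
  next
    fix y assume y: "Sup A < y"
    then have "y \<notin> A" using cSup_upper[OF _ bdd, of y] by auto
    then show "\<forall>\<^sub>F i in U. f i < y"
      using U(2)[of "\<lambda>i. y \<le> f i"] by (simp add: A_def not_le)
  qed
  moreover have "Sup A \<in> {a..b}"
    using cSup_upper[OF aA bdd] cSup_least[of A b] aA A by auto
  ultimately show thesis using that by blast
qed

locale bounded_norm_ultraproduct =
  fixes U :: "'i filter" and G :: "'i \<Rightarrow> ('a, 'b) monoid_scheme" and \<nu> :: "'i \<Rightarrow> 'a \<Rightarrow> real" and B :: real
  assumes U: "ultrafilter U"
    and grp: "\<And>n. group (G n)"
    and nrm: "\<And>n. bi_invariant_norm (G n) (\<nu> n)"
    and bdd: "\<And>n g. g \<in> carrier (G n) \<Longrightarrow> \<nu> n g \<le> B"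
begin

abbreviation "P \<equiv> product_group UNIV G"
abbreviation "E \<equiv> null_sequences U G \<nu>"

lemma U_nontriv: "U \<noteq> bot"
  using U by (simp add: ultrafilter_def)

lemma group_P: "group P"
  using grp by simp

lemma P_memD: "g \<in> carrier P \<Longrightarrow> g n \<in> carrier (G n)"
  by (auto simp: PiE_iff)

lemma P_mult: "(g \<otimes>\<^bsub>P\<^esub> h) n = g n \<otimes>\<^bsub>G n\<^esub> h n"
  by simp

lemma P_inv: "g \<in> carrier P \<Longrightarrow> (inv\<^bsub>P\<^esub> g) n = inv\<^bsub>G n\<^esub> (g n)"
  using grp by simp

lemma P_one: "\<one>\<^bsub>P\<^esub> n = \<one>\<^bsub>G n\<^esub>"
  by simp

declare mult_product_group [simp del] one_product_group [simp del] carrier_product_group [simp del]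
  inv_product_group [simp del]

lemma norm_nonneg: "g \<in> carrier (G n) \<Longrightarrow> \<nu> n g \<ge> 0"
  using bi_invariant_norm_nonneg[OF grp nrm] by blast

lemmas norm_one = bi_invariant_normD(1)[OF nrm]
lemmas norm_mult = bi_invariant_normD(2)[OF nrm]
lemmas norm_inv = bi_invariant_normD(3)[OF nrm]
lemmas norm_conj = bi_invariant_normD(4)[OF nrm]

lemma E_iff: "g \<in> E \<longleftrightarrow> g \<in> carrier P \<and> ((\<lambda>n. \<nu> n (g n)) \<longlongrightarrow> 0) U"
  by (simp add: null_sequences_def)

lemma norm_limit_exists:
  assumes "g \<in> carrier P"
  obtains l where "((\<lambda>n. \<nu> n (g n)) \<longlongrightarrow> l) U"
proof -
  have "\<And>n. \<nu> n (g n) \<in> {0..B}"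
    using norm_nonneg bdd P_memD[OF assms] by simp
  then show thesis
    using ultrafilter_limit_exists[OF U] that by metis
qed

lemma normal_E: "E \<lhd> P"
proof (rule group.normal_invI[OF group_P])
  interpret P: group P by (rule group_P)
  show "subgroup E P"
  proof (rule P.subgroupI)
    show "E \<subseteq> carrier P" by (auto simp: E_iff)
    have "\<one>\<^bsub>P\<^esub> \<in> E" by (simp add: E_iff P_one norm_one)
    then show "E \<noteq> {}" by blast
    show "inv\<^bsub>P\<^esub> g \<in> E" if "g \<in> E" for g
      using that by (simp add: E_iff P_inv norm_inv P_memD)
    show "g \<otimes>\<^bsub>P\<^esub> h \<in> E" if "g \<in> E" "h \<in> E" for g h
    proof -
      have gh: "g \<in> carrier P" "h \<in> carrier P" using that by (auto simp: E_iff)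
      have "((\<lambda>n. \<nu> n (g n) + \<nu> n (h n)) \<longlongrightarrow> 0 + 0) U"
        using that by (intro tendsto_add) (auto simp: E_iff)
      then have lim: "((\<lambda>n. \<nu> n (g n) + \<nu> n (h n)) \<longlongrightarrow> 0) U" by simp
      have "0 \<le> \<nu> n ((g \<otimes>\<^bsub>P\<^esub> h) n)" for n
        by (rule norm_nonneg[OF P_memD[OF P.m_closed[OF gh]]])
      moreover have "\<nu> n ((g \<otimes>\<^bsub>P\<^esub> h) n) \<le> \<nu> n (g n) + \<nu> n (h n)" for n
        unfolding P_mult by (rule norm_mult[OF P_memD[OF gh(1)] P_memD[OF gh(2)]])
      ultimately have "((\<lambda>n. \<nu> n ((g \<otimes>\<^bsub>P\<^esub> h) n)) \<longlongrightarrow> 0) U"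
        by (intro tendsto_sandwich[OF _ _ tendsto_const lim]) auto
      then show ?thesis using gh by (simp add: E_iff)
    qed
  qed
  show "x \<otimes>\<^bsub>P\<^esub> h \<otimes>\<^bsub>P\<^esub> inv\<^bsub>P\<^esub> x \<in> E" if "x \<in> carrier P" "h \<in> E" for x h
    using that by (simp add: E_iff P_mult P_inv norm_conj P_memD)
qed

lemma group_ultraproduct: "group (metric_ultraproduct U G \<nu>)"
  unfolding metric_ultraproduct_def by (rule normal.factorgroup_is_group[OF normal_E])

lemma norm_limit_coset:
  assumes g: "g \<in> carrier P" and h: "h \<in> E #>\<^bsub>P\<^esub> g" and l: "((\<lambda>n. \<nu> n (g n)) \<longlongrightarrow> l) U"
  shows "((\<lambda>n. \<nu> n (h n)) \<longlongrightarrow> l) U"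
proof -
  interpret P: group P by (rule group_P)
  obtain e where e: "e \<in> E" and he: "h = e \<otimes>\<^bsub>P\<^esub> g"
    using h by (auto simp: r_coset_def)
  have eP: "e \<in> carrier P" using e by (simp add: E_iff)
  have hP: "h \<in> carrier P" using he eP g by simp
  have ge: "g = inv\<^bsub>P\<^esub> e \<otimes>\<^bsub>P\<^esub> h"
    unfolding he using eP g by (simp add: P.m_assoc[symmetric])
  have up: "\<nu> n (h n) \<le> \<nu> n (g n) + \<nu> n (e n)" for n
    using norm_mult[OF P_memD[OF eP] P_memD[OF g], of n] by (simp add: he P_mult)
  have lo: "\<nu> n (g n) - \<nu> n (e n) \<le> \<nu> n (h n)" for n
  proof -
    have "\<nu> n (g n) = \<nu> n ((inv\<^bsub>P\<^esub> e) n \<otimes>\<^bsub>G n\<^esub> h n)"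
      by (subst ge) (simp add: P_mult)
    also have "\<dots> \<le> \<nu> n ((inv\<^bsub>P\<^esub> e) n) + \<nu> n (h n)"
      by (rule norm_mult[OF P_memD[OF P.inv_closed[OF eP]] P_memD[OF hP]])
    also have "\<nu> n ((inv\<^bsub>P\<^esub> e) n) = \<nu> n (e n)"
      using eP by (simp add: P_inv norm_inv P_memD)
    finally show ?thesis by simp
  qed
  have e0: "((\<lambda>n. \<nu> n (e n)) \<longlongrightarrow> 0) U" using e by (simp add: E_iff)
  have "((\<lambda>n. \<nu> n (g n) - \<nu> n (e n)) \<longlongrightarrow> l) U" "((\<lambda>n. \<nu> n (g n) + \<nu> n (e n)) \<longlongrightarrow> l) U"
    using tendsto_diff[OF l e0] tendsto_add[OF l e0] by simp_all
  then show ?thesis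
    by (rule tendsto_sandwich[rotated 2]) (use up lo in auto)
qed

theorem ultraproduct_norm_coset:
  assumes "g \<in> carrier P"
  shows "((\<lambda>n. \<nu> n (g n)) \<longlongrightarrow> ultraproduct_norm U \<nu> (E #>\<^bsub>P\<^esub> g)) U"
proof -
  interpret P: group P by (rule group_P)
  obtain l where l: "((\<lambda>n. \<nu> n (g n)) \<longlongrightarrow> l) U"
    using norm_limit_exists[OF assms] .
  have "g \<in> E #>\<^bsub>P\<^esub> g"
    using P.rcos_self[OF assms normal_imp_subgroup[OF normal_E]] .
  moreover have "l' = l" if "h \<in> E #>\<^bsub>P\<^esub> g" "((\<lambda>n. \<nu> n (h n)) \<longlongrightarrow> l') U" for h l'
    using tendsto_unique[OF U_nontriv that(2) norm_limit_coset[OF assms that(1) l]] .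
  ultimately have "ultraproduct_norm U \<nu> (E #>\<^bsub>P\<^esub> g) = l"
    unfolding ultraproduct_norm_def using l by (intro the_equality) blast+
  with l show ?thesis by simp
qed

lemma ultraproduct_norm_eqI:
  assumes "g \<in> carrier P" "((\<lambda>n. \<nu> n (g n)) \<longlongrightarrow> l) U"
  shows "ultraproduct_norm U \<nu> (E #>\<^bsub>P\<^esub> g) = l"
  using tendsto_unique[OF U_nontriv ultraproduct_norm_coset[OF assms(1)] assms(2)] .

theorem bi_invariant_ultraproduct_norm:
  "bi_invariant_norm (metric_ultraproduct U G \<nu>) (ultraproduct_norm U \<nu>)"
proof -
  interpret P: group P by (rule group_P)
  interpret E: normal E P by (rule normal_E)
  let ?Q = "P Mod E" and ?N = "ultraproduct_norm U \<nu>"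
  interpret Q: group ?Q by (rule E.factorgroup_is_group)
  let ?c = "\<lambda>g. E #>\<^bsub>P\<^esub> g"
  have car: "carrier ?Q = ?c ` carrier P" by (rule carrier_FactGroup)
  have mult: "?c g \<otimes>\<^bsub>?Q\<^esub> ?c h = ?c (g \<otimes>\<^bsub>P\<^esub> h)" if "g \<in> carrier P" "h \<in> carrier P" for g h
    using that by (simp add: E.rcos_sum)
  have inv: "inv\<^bsub>?Q\<^esub> ?c g = ?c (inv\<^bsub>P\<^esub> g)" if "g \<in> carrier P" for g
    using that by (simp add: E.inv_FactGroup car E.rcos_inv)
  have one: "\<one>\<^bsub>?Q\<^esub> = ?c \<one>\<^bsub>P\<^esub>"
    using P.coset_mult_one[OF E.subset] by simp
  note lim = ultraproduct_norm_coset
  have 1: "?N (?c \<one>\<^bsub>P\<^esub>) = 0"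
    by (rule ultraproduct_norm_eqI) (simp_all add: P_one norm_one)
  have 2: "?N (?c (g \<otimes>\<^bsub>P\<^esub> h)) \<le> ?N (?c g) + ?N (?c h)" if "g \<in> carrier P" "h \<in> carrier P" for g h
    by (rule tendsto_le[OF U_nontriv tendsto_add[OF lim[OF that(1)] lim[OF that(2)]] lim])
       (use that in \<open>simp_all add: P_mult norm_mult P_memD\<close>)
  have 3: "?N (?c (inv\<^bsub>P\<^esub> g)) = ?N (?c g)" if "g \<in> carrier P" for g
    by (rule ultraproduct_norm_eqI)
       (use that lim[OF that] in \<open>simp_all add: P_inv norm_inv P_memD\<close>)
  have 4: "?N (?c (h \<otimes>\<^bsub>P\<^esub> g \<otimes>\<^bsub>P\<^esub> inv\<^bsub>P\<^esub> h)) = ?N (?c g)" if "g \<in> carrier P" "h \<in> carrier P" for g h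
    by (rule ultraproduct_norm_eqI)
       (use that lim[OF that(1)] in \<open>simp_all add: P_inv P_mult norm_conj P_memD\<close>)
  have 5: "?c g = ?c \<one>\<^bsub>P\<^esub>" if "g \<in> carrier P" "?N (?c g) = 0" for g
  proof -
    have "g \<in> E" using lim[OF that(1)] that by (simp add: E_iff)
    then show ?thesis using E.rcos_const[OF P.group_axioms] P.coset_mult_one[OF E.subset] by simp
  qed
  have rep: "\<exists>g\<in>carrier P. X = ?c g" if "X \<in> carrier ?Q" for X
    using that car by auto
  have "bi_invariant_norm ?Q ?N"
    unfolding bi_invariant_norm_def
  proof (intro conjI ballI)
    show "?N \<one>\<^bsub>?Q\<^esub> = 0" unfolding one by (rule 1)
  next
    fix X Y assume "X \<in> carrier ?Q" "Y \<in> carrier ?Q"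
    then obtain g h where gh: "g \<in> carrier P" "X = ?c g" "h \<in> carrier P" "Y = ?c h"
      using rep by meson
    show "?N (X \<otimes>\<^bsub>?Q\<^esub> Y) \<le> ?N X + ?N Y"
      unfolding gh mult[OF gh(1,3)] by (rule 2[OF gh(1,3)])
    show "?N (Y \<otimes>\<^bsub>?Q\<^esub> X \<otimes>\<^bsub>?Q\<^esub> inv\<^bsub>?Q\<^esub> Y) = ?N X"
      unfolding gh mult[OF gh(3,1)] inv[OF gh(3)]
        mult[OF P.m_closed[OF gh(3,1)] P.inv_closed[OF gh(3)]]
      by (rule 4[OF gh(1,3)])
  next
    fix X assume "X \<in> carrier ?Q"
    then obtain g where g: "g \<in> carrier P" "X = ?c g"
      using rep by meson
    show "?N (inv\<^bsub>?Q\<^esub> X) = ?N X"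
      unfolding g inv[OF g(1)] by (rule 3[OF g(1)])
    show "?N X = 0 \<longleftrightarrow> X = \<one>\<^bsub>?Q\<^esub>"
      unfolding g one using 1 5[OF g(1)] by metis
  qed
  then show ?thesis by (simp add: metric_ultraproduct_def)
qed

end

end

(*
  Write Q for the ultraproduct and C_N(X) for the set of products of at most N conjugates of X and
  its inverse.  Simplicity of Q says that for X different from 1 the sets C_N(X) exhaust Q, and
  countable saturation of the ultraproduct makes this uniform in two ways.
  (1) For all r, e > 0 there is M such that C_M(X) is e-dense in Q whenever X has norm > r;
  otherwise saturation yields one pair X, Y such that Y stays e/2-away from every C_M(X).
  (2) Each {(X, Y). Y in C_N(X)} is closed and Q is complete, so by Baire there are N, Z, W, e such
  that Y lies in C_N(X) as soon as X is e-close to Z and Y is e-close to W.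
  Given any X of norm > r and any Y, (1) puts into C_M(X) an element e-close to Z and an element c
  e-close to Y W^-1; by (2), c^-1 Y lies in C_(N M)(X), hence Y lies in C_(M + N M)(X).
*)

theory Submission
  imports Defs
begin

section \<open>Products of conjugates\<close>

context group
begin

lemma conj_class_sym_closed:
  assumes "g \<in> carrier G"
  shows "conj_class_sym G g \<subseteq> carrier G"
  using assms by (auto simp: conj_class_sym_def)

text \<open>Cancellation in right-nested form, the form that products take once
  \<open>m_assoc\<close> has been applied.\<close>

lemma inv_mult_cancel:
  assumes "x \<in> carrier G" "y \<in> carrier G"
  shows "inv x \<otimes> (x \<otimes> y) = y" "x \<otimes> (inv x \<otimes> y) = y"
  using assms by (simp_all add: m_assoc[symmetric])

lemma conj_products_0: "conj_products 0 g G = {\<one>}"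
  by (auto simp: conj_products_def)

text \<open>Splitting off the first factor turns the list description into a recursion on N, on
  which the inductions below run. The inserted \<open>\<one>\<close> is the empty list.\<close>

lemma conj_products_Suc:
  "conj_products (Suc N) g G =
     insert \<one> {k \<otimes> c | k c. k \<in> conj_class_sym G g \<and> c \<in> conj_products N g G}"
  (is "?L = ?R")
proof
  show "?L \<subseteq> ?R"
  proof
    fix x assume "x \<in> ?L"
    then obtain xs where xs: "x = foldr (\<otimes>) xs \<one>" "length xs \<le> Suc N" "set xs \<subseteq> conj_class_sym G g"
      by (auto simp: conj_products_def)
    show "x \<in> ?R"
    proof (cases xs)
      case Nil
      then show ?thesis using xs by simp
    next
      case (Cons k ys)
      then have "foldr (\<otimes>) ys \<one> \<in> conj_products N g G"
        using xs unfolding conj_products_def by auto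
      then show ?thesis using xs Cons by auto
    qed
  qed
  show "?R \<subseteq> ?L"
  proof
    fix x assume "x \<in> ?R"
    then consider "x = \<one>"
      | k xs where "x = k \<otimes> foldr (\<otimes>) xs \<one>" "k \<in> conj_class_sym G g"
          "length xs \<le> N" "set xs \<subseteq> conj_class_sym G g"
      by (auto simp: conj_products_def)
    then show "x \<in> ?L"
    proof cases
      case 1
      then show ?thesis unfolding conj_products_def by (intro CollectI exI[of _ "[]"]) auto
    next
      case (2 k xs)
      then show ?thesis unfolding conj_products_def by (intro CollectI exI[of _ "k # xs"]) auto
    qed
  qed
qed

lemma conj_products_closed:
  assumes "g \<in> carrier G"
  shows "conj_products N g G \<subseteq> carrier G"
  using conj_class_sym_closed[OF assms]
  by (induction N) (auto simp: conj_products_0 conj_products_Suc)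

lemma conj_products_mono: "M \<le> N \<Longrightarrow> conj_products M g G \<subseteq> conj_products N g G"
  unfolding conj_products_def by (auto intro: order_trans)

lemma one_in_conj_products: "\<one> \<in> conj_products N g G"
  by (cases N) (auto simp: conj_products_0 conj_products_Suc)

lemma conj_class_sym_subset_conj_products:
  assumes "g \<in> carrier G"
  shows "conj_class_sym G g \<subseteq> conj_products (Suc N) g G"
proof
  fix k assume k: "k \<in> conj_class_sym G g"
  then have "k \<otimes> \<one> \<in> conj_products (Suc N) g G"
    using one_in_conj_products[of N g] by (auto simp: conj_products_Suc)
  then show "k \<in> conj_products (Suc N) g G"
    using k conj_class_sym_closed[OF assms] by auto
qed

text \<open>The lists of factors are concatenated. When x is \<open>\<one>\<close> nothing is
  prepended, and \<open>conj_products_mono\<close> absorbs the spare length.\<close>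

lemma conj_products_mult:
  assumes "g \<in> carrier G" "x \<in> conj_products M g G" "y \<in> conj_products N g G"
  shows "x \<otimes> y \<in> conj_products (M + N) g G"
  using assms(2)
proof (induction M arbitrary: x)
  case 0
  have "y \<in> carrier G" using assms(3) conj_products_closed[OF assms(1)] by auto
  then show ?case using 0 assms(3) by (simp add: conj_products_0)
next
  case (Suc M)
  have y: "y \<in> carrier G" using assms(3) conj_products_closed[OF assms(1)] by auto
  from Suc.prems consider "x = \<one>"
    | k c where "x = k \<otimes> c" "k \<in> conj_class_sym G g" "c \<in> conj_products M g G"
    by (auto simp: conj_products_Suc)
  then show ?case
  proof cases
    case 1
    then show ?thesis
      using y subsetD[OF conj_products_mono assms(3), of "Suc M + N"] by simp
  next
    case 2
    have "x \<otimes> y = k \<otimes> (c \<otimes> y)"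
      using 2 y conj_class_sym_closed[OF assms(1)] conj_products_closed[OF assms(1), of M]
      by (auto intro!: m_assoc)
    then show ?thesis using Suc.IH[OF 2(3)] 2(2) by (auto simp: conj_products_Suc)
  qed
qed

section \<open>Inversion, conjugation and substitution in products of conjugates\<close>

lemma conj_class_sym_inv:
  assumes "g \<in> carrier G" "k \<in> conj_class_sym G g"
  shows "inv k \<in> conj_class_sym G g"
proof -
  obtain h x where "h \<in> carrier G" "x \<in> {g, inv g}" "k = h \<otimes> x \<otimes> inv h"
    using assms(2) by (auto simp: conj_class_sym_def)
  then have "inv k = h \<otimes> inv x \<otimes> inv h" "inv x \<in> {g, inv g}"
    using assms(1) by (auto simp: inv_mult_group m_assoc)
  then show ?thesis using \<open>h \<in> carrier G\<close> unfolding conj_class_sym_def by blast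
qed

lemma conj_class_sym_conj:
  assumes "g \<in> carrier G" "k \<in> conj_class_sym G g" "h \<in> carrier G"
  shows "h \<otimes> k \<otimes> inv h \<in> conj_class_sym G g"
proof -
  obtain u x where u: "u \<in> carrier G" "x \<in> {g, inv g}" "k = u \<otimes> x \<otimes> inv u"
    using assms(2) by (auto simp: conj_class_sym_def)
  then have "h \<otimes> k \<otimes> inv h = (h \<otimes> u) \<otimes> x \<otimes> inv (h \<otimes> u)"
    using assms by (auto simp: inv_mult_group m_assoc)
  then show ?thesis using u assms(3) unfolding conj_class_sym_def by blast
qed

text \<open>Inversion reverses the order of the factors, so the inverted first factor has to be
  appended on the right, by \<open>conj_products_mult\<close>.\<close>

lemma conj_products_inv:
  assumes "g \<in> carrier G" "x \<in> conj_products N g G"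
  shows "inv x \<in> conj_products N g G"
  using assms(2)
proof (induction N arbitrary: x)
  case 0
  then show ?case by (simp add: conj_products_0)
next
  case (Suc N)
  from Suc.prems consider "x = \<one>"
    | k c where "x = k \<otimes> c" "k \<in> conj_class_sym G g" "c \<in> conj_products N g G"
    by (auto simp: conj_products_Suc)
  then show ?case
  proof cases
    case 1
    then show ?thesis by (simp add: one_in_conj_products)
  next
    case 2
    have "k \<in> carrier G" "c \<in> carrier G"
      using 2 conj_class_sym_closed[OF assms(1)] conj_products_closed[OF assms(1)] by blast+
    then have "inv x = inv c \<otimes> inv k" using 2 by (simp add: inv_mult_group)
    moreover have "inv k \<in> conj_products (Suc 0) g G"
      using conj_class_sym_inv[OF assms(1) 2(2)] conj_class_sym_subset_conj_products[OF assms(1)]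
      by blast
    ultimately show ?thesis using conj_products_mult[OF assms(1) Suc.IH[OF 2(3)]] by fastforce
  qed
qed

text \<open>Conjugation by h is a homomorphism, so it acts on each factor separately.\<close>

lemma conj_products_conj:
  assumes "g \<in> carrier G" "x \<in> conj_products N g G" "h \<in> carrier G"
  shows "h \<otimes> x \<otimes> inv h \<in> conj_products N g G"
  using assms(2)
proof (induction N arbitrary: x)
  case 0
  then show ?case using assms by (simp add: conj_products_0)
next
  case (Suc N)
  from Suc.prems consider "x = \<one>"
    | k c where "x = k \<otimes> c" "k \<in> conj_class_sym G g" "c \<in> conj_products N g G"
    by (auto simp: conj_products_Suc)
  then show ?case
  proof cases
    case 1
    then show ?thesis using assms by (simp add: one_in_conj_products)
  next
    case 2
    have kc: "k \<in> carrier G" "c \<in> carrier G"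
      using 2 conj_class_sym_closed[OF assms(1)] conj_products_closed[OF assms(1)] by blast+
    then have "h \<otimes> x \<otimes> inv h = (h \<otimes> k \<otimes> inv h) \<otimes> (h \<otimes> c \<otimes> inv h)"
      using 2(1) assms(3) by (simp add: m_assoc inv_mult_cancel)
    then show ?thesis
      using conj_class_sym_conj[OF assms(1) 2(2) assms(3)] Suc.IH[OF 2(3)]
      by (auto simp: conj_products_Suc)
  qed
qed

text \<open>Each of the at most N factors is a conjugate of x or \<open>inv x\<close>, hence itself
  a product of at most M conjugates of g and \<open>inv g\<close>.\<close>

lemma conj_products_trans:
  assumes "g \<in> carrier G" "x \<in> conj_products M g G" "y \<in> conj_products N x G"
  shows "y \<in> conj_products (N * M) g G"
  using assms(3)
proof (induction N arbitrary: y)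
  case 0
  then show ?case by (simp add: conj_products_0)
next
  case (Suc N)
  from Suc.prems consider "y = \<one>"
    | k c where "y = k \<otimes> c" "k \<in> conj_class_sym G x" "c \<in> conj_products N x G"
    by (auto simp: conj_products_Suc)
  then show ?case
  proof cases
    case 1
    then show ?thesis by (simp add: one_in_conj_products)
  next
    case 2
    then have "k \<in> conj_products M g G"
      using conj_products_conj[OF assms(1)] conj_products_inv[OF assms(1,2)] assms(2)
      unfolding conj_class_sym_def by blast
    then show ?thesis
      using conj_products_mult[OF assms(1) _ Suc.IH[OF 2(3)]] 2(1) by simp
  qed
qed

text \<open>This union is the normal closure of g: lengths add under multiplication, and inversion
  and conjugation do not increase them.\<close>

lemma normal_Union_conj_products:
  assumes "g \<in> carrier G"
  shows "(\<Union>N. conj_products N g G) \<lhd> G"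
proof (rule normal_invI)
  show "subgroup (\<Union>N. conj_products N g G) G"
  proof (rule subgroupI)
    show "(\<Union>N. conj_products N g G) \<subseteq> carrier G"
      using conj_products_closed[OF assms] by blast
    show "(\<Union>N. conj_products N g G) \<noteq> {}"
      using one_in_conj_products by blast
    show "inv x \<in> (\<Union>N. conj_products N g G)" if "x \<in> (\<Union>N. conj_products N g G)" for x
      using that conj_products_inv[OF assms] by blast
    show "x \<otimes> y \<in> (\<Union>N. conj_products N g G)"
      if "x \<in> (\<Union>N. conj_products N g G)" "y \<in> (\<Union>N. conj_products N g G)" for x y
      using that conj_products_mult[OF assms] by (elim UN_E) (rule UN_I[OF UNIV_I])
  qed
  show "h \<otimes> x \<otimes> inv h \<in> (\<Union>N. conj_products N g G)"
    if "h \<in> carrier G" "x \<in> (\<Union>N. conj_products N g G)" for h x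
    using that conj_products_conj[OF assms] by blast
qed

text \<open>The normal closure of g contains g, so simplicity forces it to be the whole group. The N
  obtained depends on g and x; making it uniform is the purpose of what follows.\<close>

lemma abstractly_simple_conj_products:
  assumes "abstractly_simple G" "g \<in> carrier G" "g \<noteq> \<one>" "x \<in> carrier G"
  obtains N where "x \<in> conj_products N g G"
proof -
  have "\<one> \<otimes> g \<otimes> inv \<one> \<in> conj_class_sym G g"
    unfolding conj_class_sym_def by blast
  then have "g \<in> (\<Union>N. conj_products N g G)"
    using conj_class_sym_subset_conj_products[OF assms(2)] assms(2) by auto
  then have "(\<Union>N. conj_products N g G) = carrier G"
    using normal_Union_conj_products[OF assms(2)] assms(1,3) unfolding abstractly_simple_def by blast
  then show thesis using that assms(4) by blast
qed

end

section \<open>The metric of a bi-invariant norm\<close>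

text \<open>The left-invariant metric of the norm. Group and norm are parameters because it is used
  both in each \<open>G n\<close> and in the ultraproduct.\<close>

definition norm_dist :: "('a, 'b) monoid_scheme \<Rightarrow> ('a \<Rightarrow> real) \<Rightarrow> 'a \<Rightarrow> 'a \<Rightarrow> real" where
  "norm_dist G \<nu> x y = \<nu> (inv\<^bsub>G\<^esub> x \<otimes>\<^bsub>G\<^esub> y)"

locale bi_invariant_normed_group = group G for G (structure) +
  fixes \<nu> :: "'a \<Rightarrow> real"
  assumes bi_invariant_norm: "bi_invariant_norm G \<nu>"
begin

lemmas norm_one = bi_invariant_normD(1)[OF bi_invariant_norm]
  and norm_mult = bi_invariant_normD(2)[OF bi_invariant_norm]
  and norm_inv = bi_invariant_normD(3)[OF bi_invariant_norm]
  and norm_conj = bi_invariant_normD(4)[OF bi_invariant_norm]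

abbreviation d :: "'a \<Rightarrow> 'a \<Rightarrow> real" where "d \<equiv> norm_dist G \<nu>"

lemma dist_refl: "x \<in> carrier G \<Longrightarrow> d x x = 0"
  by (simp add: norm_dist_def norm_one)

lemma dist_nonneg: "x \<in> carrier G \<Longrightarrow> y \<in> carrier G \<Longrightarrow> d x y \<ge> 0"
  unfolding norm_dist_def
  by (rule bi_invariant_norm_nonneg[OF is_group bi_invariant_norm]) simp

lemma dist_sym:
  assumes "x \<in> carrier G" "y \<in> carrier G"
  shows "d x y = d y x"
proof -
  have "inv (inv x \<otimes> y) = inv y \<otimes> x" using assms by (simp add: inv_mult_group)
  then show ?thesis using norm_inv[of "inv x \<otimes> y"] assms by (simp add: norm_dist_def)
qed

lemma dist_triangle:
  assumes "x \<in> carrier G" "y \<in> carrier G" "z \<in> carrier G"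
  shows "d x z \<le> d x y + d y z"
proof -
  have "inv x \<otimes> z = (inv x \<otimes> y) \<otimes> (inv y \<otimes> z)"
    using assms by (simp add: m_assoc inv_mult_cancel)
  then show ?thesis using norm_mult[of "inv x \<otimes> y" "inv y \<otimes> z"] assms by (simp add: norm_dist_def)
qed

lemma norm_le_dist:
  assumes "x \<in> carrier G" "y \<in> carrier G"
  shows "\<nu> y \<le> \<nu> x + d x y"
proof -
  have "y = x \<otimes> (inv x \<otimes> y)" using assms by (simp add: m_assoc[symmetric])
  then show ?thesis using norm_mult[of x "inv x \<otimes> y"] assms by (simp add: norm_dist_def)
qed

lemma dist_mult_left:
  assumes "x \<in> carrier G" "y \<in> carrier G" "z \<in> carrier G"
  shows "d (z \<otimes> x) (z \<otimes> y) = d x y"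
proof -
  have "inv (z \<otimes> x) \<otimes> (z \<otimes> y) = inv x \<otimes> y"
    using assms by (simp add: inv_mult_group m_assoc inv_mult_cancel)
  then show ?thesis by (simp add: norm_dist_def)
qed

text \<open>Conjugation invariance enters here:
  \<open>inv (x \<otimes> z) \<otimes> (y \<otimes> z)\<close> is the conjugate of
  \<open>inv x \<otimes> y\<close> by \<open>inv z\<close>.\<close>

lemma dist_mult_right:
  assumes "x \<in> carrier G" "y \<in> carrier G" "z \<in> carrier G"
  shows "d (x \<otimes> z) (y \<otimes> z) = d x y"
proof -
  have "inv (x \<otimes> z) \<otimes> (y \<otimes> z) = inv z \<otimes> (inv x \<otimes> y) \<otimes> inv (inv z)"
    using assms by (simp add: inv_mult_group m_assoc)
  then show ?thesis using norm_conj[of "inv x \<otimes> y" "inv z"] assms by (simp add: norm_dist_def)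
qed

lemma dist_mult:
  assumes "x \<in> carrier G" "y \<in> carrier G" "x' \<in> carrier G" "y' \<in> carrier G"
  shows "d (x \<otimes> y) (x' \<otimes> y') \<le> d x x' + d y y'"
  using dist_triangle[of "x \<otimes> y" "x' \<otimes> y" "x' \<otimes> y'"] dist_mult_left dist_mult_right assms by simp

text \<open>Multiplying by x on the left and by y on the right carries the pair
  \<open>inv x\<close>, \<open>inv y\<close> to the pair y, x.\<close>

lemma dist_inv:
  assumes "x \<in> carrier G" "y \<in> carrier G"
  shows "d (inv x) (inv y) = d x y"
proof -
  have "d (inv x) (inv y) = d (x \<otimes> inv x) (x \<otimes> inv y)"
    by (rule dist_mult_left[symmetric]) (use assms in simp_all)
  also have "\<dots> = d (x \<otimes> inv x \<otimes> y) (x \<otimes> inv y \<otimes> y)"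
    by (rule dist_mult_right[symmetric]) (use assms in simp_all)
  also have "\<dots> = d y x" using assms by (simp add: m_assoc)
  finally show ?thesis using dist_sym assms by simp
qed

section \<open>Lipschitz dependence of C_N(x) on x\<close>

lemma conj_class_sym_lipschitz:
  assumes "x \<in> carrier G" "y \<in> carrier G" "k \<in> conj_class_sym G x"
  obtains l where "l \<in> conj_class_sym G y" "d k l = d x y"
proof -
  obtain h u where h: "h \<in> carrier G" "k = h \<otimes> u \<otimes> inv h" "u \<in> {x, inv x}"
    using assms(3) by (auto simp: conj_class_sym_def)
  obtain v where v: "v \<in> {y, inv y}" "d u v = d x y"
    using h(3) dist_inv[OF assms(1,2)] by blast
  have "d k (h \<otimes> v \<otimes> inv h) = d x y"
    using h v assms by (auto simp: dist_mult_right dist_mult_left)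
  moreover have "h \<otimes> v \<otimes> inv h \<in> conj_class_sym G y"
    using h(1) v(1) unfolding conj_class_sym_def by blast
  ultimately show thesis using that by blast
qed

text \<open>Keep the conjugators and exponents and replace x by y in every factor: each replacement
  costs \<open>d x y\<close>, and by invariance the costs add up.\<close>

lemma conj_products_lipschitz:
  assumes "x \<in> carrier G" "y \<in> carrier G" "a \<in> conj_products N x G"
  shows "\<exists>b\<in>conj_products N y G. d a b \<le> N * d x y"
  using assms(3)
proof (induction N arbitrary: a)
  case 0
  then show ?case by (simp add: conj_products_0 dist_refl)
next
  case (Suc N)
  from Suc.prems consider "a = \<one>"
    | k c where "a = k \<otimes> c" "k \<in> conj_class_sym G x" "c \<in> conj_products N x G"
    by (auto simp: conj_products_Suc)
  then show ?case
  proof cases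
    case 1
    then show ?thesis
      using dist_nonneg[OF assms(1,2)] one_in_conj_products by (auto simp: dist_refl intro!: bexI[of _ \<one>])
  next
    case 2
    obtain e where e: "e \<in> conj_products N y G" "d c e \<le> N * d x y" using Suc.IH[OF 2(3)] by blast
    obtain l where l: "l \<in> conj_class_sym G y" "d k l = d x y"
      using conj_class_sym_lipschitz[OF assms(1,2) 2(2)] .
    have "d a (l \<otimes> e) \<le> d k l + d c e"
      unfolding 2(1)
      by (intro dist_mult) (use 2 e l conj_class_sym_closed conj_products_closed assms in blast)+
    also have "\<dots> \<le> Suc N * d x y" using e l by (simp add: algebra_simps)
    finally show ?thesis using e(1) l(1) by (auto simp: conj_products_Suc)
  qed
qed

text \<open>A Baire category argument on pairs. If no box lay inside a relation
  \<open>y \<in> conj_products N x G\<close>, shrinking boxes could be chosen to avoid these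
  relations for all N in turn, and a common point would contradict simplicity. \<open>nested\<close>
  stands in for completeness and does not ask the radii to tend to 0.\<close>

lemma conj_products_interior:
  assumes simple: "abstractly_simple G"
    and closed: "\<And>N x y. x \<in> carrier G \<Longrightarrow> y \<in> carrier G \<Longrightarrow>
      (\<And>e. e > 0 \<Longrightarrow> \<exists>c\<in>conj_products N x G. d c y < e) \<Longrightarrow> y \<in> conj_products N x G"
    and nested: "\<And>f (e :: nat \<Rightarrow> real). (\<And>k. f k \<in> carrier G) \<Longrightarrow>
      (\<And>j k. j \<le> k \<Longrightarrow> d (f k) (f j) < e j) \<Longrightarrow> \<exists>x\<in>carrier G. \<forall>j. d x (f j) \<le> e j"
    and r: "r \<ge> 0" and g: "g \<in> carrier G" "\<nu> g > r"
  obtains z w e N where "z \<in> carrier G" "w \<in> carrier G" "e > 0"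
    "\<And>x y. x \<in> carrier G \<Longrightarrow> y \<in> carrier G \<Longrightarrow> d x z < e \<Longrightarrow> d y w < e \<Longrightarrow> y \<in> conj_products N x G"
proof (rule ccontr)
  note witness = that
  assume no: "\<not> thesis"
  have avoid: "\<exists>x\<in>carrier G. \<exists>y\<in>carrier G. d x z < e \<and> d y w < e \<and> y \<notin> conj_products N x G"
    if "z \<in> carrier G" "w \<in> carrier G" "e > 0" for z w e N
  proof (rule ccontr)
    assume "\<not> ?thesis"
    then show False using no witness[OF that, of N] by blast
  qed
  \<comment> \<open>A state holds two centres and a common radius. The last condition keeps the norm
    above r on the closed ball around x, so that the limit is not \<open>\<one>\<close>.\<close>
  define I where "I = (\<lambda>(x, y, e). x \<in> carrier G \<and> y \<in> carrier G \<and> e > 0 \<and> \<nu> x > r + e)"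
  \<comment> \<open>The two strict inequalities put the new closed balls inside the old open ones;
    the last clause makes the whole new box miss the k-th relation.\<close>
  define S where "S = (\<lambda>k (x, y, e) (x', y', e').
    d x' x + e' < e \<and> d y' y + e' < e \<and>
    (\<forall>x''\<in>carrier G. \<forall>y''\<in>carrier G. d x'' x' \<le> e' \<longrightarrow> d y'' y' \<le> e' \<longrightarrow> y'' \<notin> conj_products k x'' G))"
  have step: "\<exists>t. I t \<and> S k s t" if "I s" for s k
  proof -
    obtain x y e where s: "s = (x, y, e)" by (cases s)
    have xy: "x \<in> carrier G" "y \<in> carrier G" "e > 0" "\<nu> x > r + e" using that by (auto simp: s I_def)
    obtain x' y' where x': "x' \<in> carrier G" "y' \<in> carrier G" "d x' x < e / 2" "d y' y < e / 2"
      "y' \<notin> conj_products k x' G"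
      using avoid[OF xy(1,2), of "e / 2" k] xy(3) by auto
    \<comment> \<open>By \<open>closed\<close>, y' has positive distance from the set of products
      for x', and a bounds it from below.\<close>
    obtain a where a: "a > 0" "\<And>c. c \<in> conj_products k x' G \<Longrightarrow> d c y' \<ge> a"
      using closed[OF x'(1,2), of k] x'(5) by (meson not_le)
    \<comment> \<open>The first bound keeps the new balls inside the old. For the second, moving the
      pair by at most e' changes the distance to a product by at most k e' on account of x and e' on
      account of y; k + 2 in place of k + 1 makes the total strictly less than a.\<close>
    define e' where "e' = min (e / 2) (a / (k + 2))"
    have e': "e' > 0" "e' \<le> e / 2" "e' \<le> a / (k + 2)"
      using a(1) xy(3) unfolding e'_def by (simp_all only: min_less_iff_conj min.cobounded1 min.cobounded2) simp
    then have ka: "(k + 2) * e' \<le> a" by (simp add: pos_le_divide_eq mult.commute)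
    have "y'' \<notin> conj_products k x'' G"
      if h: "x'' \<in> carrier G" "y'' \<in> carrier G" "d x'' x' \<le> e'" "d y'' y' \<le> e'" for x'' y''
    proof
      assume "y'' \<in> conj_products k x'' G"
      then obtain c where c: "c \<in> conj_products k x' G" "d y'' c \<le> k * d x'' x'"
        using conj_products_lipschitz[OF h(1) x'(1)] by blast
      have cG: "c \<in> carrier G" using c conj_products_closed[OF x'(1)] by blast
      have "a \<le> d c y'" using a c by blast
      also have "\<dots> \<le> d y'' c + d y'' y'"
        using dist_triangle[OF cG h(2) x'(2)] dist_sym[OF cG h(2)] by simp
      also have "\<dots> \<le> k * e' + e'"
        using c h mult_left_mono[OF h(3), of "real k"] by simp
      also have "\<dots> < (k + 2) * e'" using e' by (simp add: algebra_simps)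
      finally show False using ka by simp
    qed
    moreover have "\<nu> x' > r + e'"
      using norm_le_dist[OF x'(1) xy(1)] xy x' e' by simp
    ultimately show ?thesis
      using x' e' by (intro exI[of _ "(x', y', e')"]) (auto simp: s I_def S_def)
  qed
  \<comment> \<open>The norm of g leaves room for a first ball; the second centre is arbitrary, and
    g is merely at hand.\<close>
  have "\<exists>t. I t"
    using g by (intro exI[of _ "(g, g, (\<nu> g - r) / 2)"]) (auto simp: I_def field_simps)
  then obtain F where F: "\<And>k. I (F k)" "\<And>k. S k (F k) (F (Suc k))"
    using dependent_nat_choice[of "\<lambda>_. I" S] step by metis
  define X Y e where "X = (\<lambda>k. fst (F k))" and "Y = (\<lambda>k. fst (snd (F k)))"
    and "e = (\<lambda>k. snd (snd (F k)))"
  have FXY: "F k = (X k, Y k, e k)" for k by (simp add: X_def Y_def e_def)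
  have inv: "X k \<in> carrier G" "Y k \<in> carrier G" "e k > 0" "\<nu> (X k) > r + e k" for k
    using F(1)[of k] by (auto simp: FXY I_def)
  have rec: "d (X (Suc k)) (X k) + e (Suc k) < e k" "d (Y (Suc k)) (Y k) + e (Suc k) < e k"
    "\<And>x y. x \<in> carrier G \<Longrightarrow> y \<in> carrier G \<Longrightarrow> d x (X (Suc k)) \<le> e (Suc k) \<Longrightarrow>
       d y (Y (Suc k)) \<le> e (Suc k) \<Longrightarrow> y \<notin> conj_products k x G" for k
    using F(2)[of k] by (auto simp: FXY S_def)
  have balls: "d (f k) (f j) < e j"
    if "\<And>k. f k \<in> carrier G" "\<And>k. d (f (Suc k)) (f k) + e (Suc k) < e k" "j \<le> k" for f j k
  proof -
    \<comment> \<open>Carrying \<open>e k\<close> along makes the estimates telescope; its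
      positivity then gives the strict inequality that \<open>nested\<close> asks for.\<close>
    have "d (f k) (f j) + e k \<le> e j"
      using that(3)
    proof (induction k rule: dec_induct)
      case base
      then show ?case using that(1) by (simp add: dist_refl)
    next
      case (step k)
      then show ?case
        using dist_triangle[of "f (Suc k)" "f k" "f j"] that(1) that(2)[of k] by fastforce
    qed
    then show ?thesis using inv(3)[of k] by simp
  qed
  obtain x where x: "x \<in> carrier G" "\<And>j. d x (X j) \<le> e j"
    using nested[of X e] balls[of X] inv(1) rec(1) by blast
  obtain y where y: "y \<in> carrier G" "\<And>j. d y (Y j) \<le> e j"
    using nested[of Y e] balls[of Y] inv(2) rec(2) by blast
  have "\<nu> x > 0"
    using norm_le_dist[OF x(1) inv(1)[of 0]] x(2)[of 0] inv(4)[of 0] r by simp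
  then have "x \<noteq> \<one>" using norm_one by auto
  then obtain N where "y \<in> conj_products N x G"
    using abstractly_simple_conj_products[OF simple x(1) _ y(1)] by blast
  \<comment> \<open>Simplicity fixes N for the limit pair, but that pair lies in the box with index
    \<open>Suc N\<close>, which misses the N-th relation.\<close>
  then show False using rec(3)[OF x(1) y(1) x(2) y(2)] by blast
qed

text \<open>\<open>closed\<close>, \<open>nested\<close> and \<open>dense\<close> isolate what is
  used of saturation. For each r > 0 a single K is found with C_K(x) equal to the whole group for
  every x of norm > r, which covers all balls.\<close>

lemma metrically_uniformly_simple_if_dense:
  assumes simple: "abstractly_simple G"
    and closed: "\<And>N x y. x \<in> carrier G \<Longrightarrow> y \<in> carrier G \<Longrightarrow>
      (\<And>e. e > 0 \<Longrightarrow> \<exists>c\<in>conj_products N x G. d c y < e) \<Longrightarrow> y \<in> conj_products N x G"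
    and nested: "\<And>f (e :: nat \<Rightarrow> real). (\<And>k. f k \<in> carrier G) \<Longrightarrow>
      (\<And>j k. j \<le> k \<Longrightarrow> d (f k) (f j) < e j) \<Longrightarrow> \<exists>x\<in>carrier G. \<forall>j. d x (f j) \<le> e j"
    and dense: "\<And>r e. r > 0 \<Longrightarrow> e > 0 \<Longrightarrow>
      \<exists>M. \<forall>x\<in>carrier G. \<nu> x > r \<longrightarrow> (\<forall>y\<in>carrier G. \<exists>c\<in>conj_products M x G. d c y < e)"
  shows "metrically_uniformly_simple G \<nu>"
proof -
  have "\<exists>K. \<forall>x\<in>carrier G. \<nu> x > r \<longrightarrow> carrier G \<subseteq> conj_products K x G" if r: "r > 0" for r
  proof (cases "\<exists>g\<in>carrier G. \<nu> g > r")
    case True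
    then obtain g where g: "g \<in> carrier G" "\<nu> g > r" by blast
    obtain z w e N where z: "z \<in> carrier G" "w \<in> carrier G" "e > 0"
      and N: "\<And>x y. x \<in> carrier G \<Longrightarrow> y \<in> carrier G \<Longrightarrow> d x z < e \<Longrightarrow> d y w < e \<Longrightarrow>
        y \<in> conj_products N x G"
      using conj_products_interior[OF simple closed nested less_imp_le[OF r] g] by blast
    obtain M where M: "\<And>x y. x \<in> carrier G \<Longrightarrow> \<nu> x > r \<Longrightarrow> y \<in> carrier G \<Longrightarrow>
        \<exists>c\<in>conj_products M x G. d c y < e"
      using dense[OF r z(3)] by blast
    have "y \<in> conj_products (M + N * M) x G"
      if x: "x \<in> carrier G" "\<nu> x > r" and y: "y \<in> carrier G" for x y
    proof -
      note car = subsetD[OF conj_products_closed[OF x(1)]]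
      obtain x' where x': "x' \<in> conj_products M x G" "d x' z < e" using M[OF x z(1)] by blast
      \<comment> \<open>The target is \<open>y \<otimes> inv w\<close> so that
        \<open>inv c \<otimes> y\<close> comes close to w.\<close>
      obtain c where c: "c \<in> conj_products M x G" "d c (y \<otimes> inv w) < e"
        using M[OF x, of "y \<otimes> inv w"] y z by auto
      \<comment> \<open>Here w is written as \<open>inv (y \<otimes> inv w) \<otimes> y\<close>, so
        that y cancels by right invariance.\<close>
      have "d (inv c \<otimes> y) w = d (inv (y \<otimes> inv w) \<otimes> y) (inv c \<otimes> y)"
        using car[OF c(1)] y z dist_sym by (simp add: inv_mult_group m_assoc)
      also have "\<dots> = d c (y \<otimes> inv w)"
        using car[OF c(1)] y z dist_sym by (simp add: dist_mult_right dist_inv)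
      finally have "inv c \<otimes> y \<in> conj_products N x' G"
        using N[OF car[OF x'(1)], of "inv c \<otimes> y"] car[OF c(1)] y x'(2) c(2) by simp
      then have "inv c \<otimes> y \<in> conj_products (N * M) x G"
        by (rule conj_products_trans[OF x(1) x'(1)])
      then have "c \<otimes> (inv c \<otimes> y) \<in> conj_products (M + N * M) x G"
        by (rule conj_products_mult[OF x(1) c(1)])
      then show ?thesis using car[OF c(1)] y by (simp add: m_assoc[symmetric])
    qed
    then show ?thesis by blast
  qed auto
  then have "\<exists>K. \<forall>x\<in>carrier G. \<nu> x \<in> {r<..t} \<longrightarrow> norm_ball G \<nu> t \<subseteq> conj_products K x G"
    if "r > 0" for r t
    using that unfolding norm_ball_def by fastforce
  then show ?thesis
    unfolding metrically_uniformly_simple_def by blast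
qed

end

section \<open>Countable saturation of the metric ultraproduct\<close>

text \<open>An ultrafilter in which some singleton is large is principal; hence each point, and so
  each finite set, can be left out.\<close>

lemma non_principal_ultrafilter_eventually_ge:
  fixes U :: "nat filter"
  assumes "ultrafilter U" "non_principal U"
  shows "\<forall>\<^sub>F n in U. n \<ge> k"
proof -
  have "\<forall>\<^sub>F n in U. n \<noteq> x" for x
  proof (rule ccontr)
    assume "\<not> (\<forall>\<^sub>F n in U. n \<noteq> x)"
    then have x: "\<forall>\<^sub>F n in U. n = x" using assms(1) by (auto simp: ultrafilter_def)
    have "P x" if "eventually P U" for P
    proof -
      have "\<forall>\<^sub>F n in U. P x" using that x by eventually_elim simp
      then show ?thesis using assms(1) by (simp add: ultrafilter_def eventually_const)
    qed
    then have "U = principal {x}"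
      using x unfolding filter_eq_iff eventually_principal by (auto elim: eventually_mono)
    then show False using assms(2) by (simp add: non_principal_def)
  qed
  then have "\<forall>\<^sub>F n in U. \<forall>x\<in>{..<k}. n \<noteq> x"
    by (simp add: eventually_ball_finite)
  then show ?thesis by (rule eventually_mono) (auto simp: not_less[symmetric])
qed

text \<open>In coordinate n pick an element meeting as long an initial segment of the conditions as
  possible, with indices at most n. For fixed k almost every n is at least k and admits a solution
  of the conditions up to k, so the chosen element solves them too.\<close>

lemma countable_saturation:
  fixes U :: "nat filter" and \<phi> :: "nat \<Rightarrow> nat \<Rightarrow> 'z \<Rightarrow> bool"
  assumes "ultrafilter U" "non_principal U"
    and ne: "\<And>n. A n \<noteq> {}"
    and sat: "\<And>k. \<forall>\<^sub>F n in U. \<exists>z\<in>A n. \<forall>j\<le>k. \<phi> j n z"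
  obtains z where "\<And>n. z n \<in> A n" "\<And>k. \<forall>\<^sub>F n in U. \<phi> k n (z n)"
proof -
  define Q where "Q = (\<lambda>n k z. z \<in> A n \<and> (\<forall>j\<le>k. \<phi> j n z))"
  have "\<exists>z\<in>A n. \<forall>k\<le>n. (\<exists>z'. Q n k z') \<longrightarrow> Q n k z" for n
  proof (cases "\<exists>k\<le>n. \<exists>z. Q n k z")
    case True
    \<comment> \<open>The cap \<open>k \<le> n\<close> makes the maximum exist even when every
      initial segment can be met; it is harmless, since \<open>n \<ge> k\<close> holds eventually
      for each k.\<close>
    define K where "K = (GREATEST k. k \<le> n \<and> (\<exists>z. Q n k z))"
    have "K \<le> n \<and> (\<exists>z. Q n K z)"
      unfolding K_def using True by (rule GreatestI_ex_nat[where b = n]) auto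
    then obtain z where z: "Q n K z" by blast
    have "k \<le> K" if "k \<le> n" "\<exists>z'. Q n k z'" for k
      unfolding K_def by (rule Greatest_le_nat[where b = n]) (use that in auto)
    then have "Q n k z" if "k \<le> n" "\<exists>z'. Q n k z'" for k
      using z that unfolding Q_def by (meson order_trans)
    then show ?thesis using z by (intro bexI[of _ z]) (auto simp: Q_def)
  next
    case False
    then show ?thesis using ne[of n] by blast
  qed
  then obtain z where z: "\<And>n. z n \<in> A n" "\<And>n k. k \<le> n \<Longrightarrow> \<exists>z'. Q n k z' \<Longrightarrow> Q n k (z n)"
    by metis
  have "\<forall>\<^sub>F n in U. \<phi> k n (z n)" for k
    using sat[of k] non_principal_ultrafilter_eventually_ge[OF assms(1,2), of k]
  proof eventually_elim
    case (elim n)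
    then have "\<exists>z'. Q n k z'" by (auto simp: Q_def)
    then have "Q n k (z n)" using z(2) elim by blast
    then show ?case by (simp add: Q_def)
  qed
  then show thesis using that z(1) by blast
qed

text \<open>Ultrafilters are prime. This transfers the disjunctions hidden in products of
  conjugates: x or its inverse, trivial product or one with a first factor.\<close>

lemma ultrafilter_disj:
  assumes "ultrafilter U" "\<forall>\<^sub>F n in U. R n \<or> S n"
  shows "(\<forall>\<^sub>F n in U. R n) \<or> (\<forall>\<^sub>F n in U. S n)"
proof (rule disjCI)
  assume "\<not> (\<forall>\<^sub>F n in U. S n)"
  then have "\<forall>\<^sub>F n in U. \<not> S n" using assms(1) by (auto simp: ultrafilter_def)
  then show "\<forall>\<^sub>F n in U. R n" using assms(2) by eventually_elim blast
qed

section \<open>Passing between the ultraproduct and its coordinates\<close>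

context bounded_norm_ultraproduct
begin

declare mult_product_group [simp del] one_product_group [simp del] carrier_product_group [simp del]
  inv_product_group [simp del]

abbreviation "Q \<equiv> metric_ultraproduct U G \<nu>"
abbreviation "cls g \<equiv> E #>\<^bsub>P\<^esub> g"
abbreviation "dQ \<equiv> norm_dist Q (ultraproduct_norm U \<nu>)"
abbreviation "dG n \<equiv> norm_dist (G n) (\<nu> n)"

lemma P_memI: "(\<And>n. g n \<in> carrier (G n)) \<Longrightarrow> g \<in> carrier P"
  by (auto simp: carrier_product_group)

lemma normed_G: "bi_invariant_normed_group (G n) (\<nu> n)"
  using grp nrm by (simp add: bi_invariant_normed_group_def bi_invariant_normed_group_axioms_def)

lemma normed_Q: "bi_invariant_normed_group Q (ultraproduct_norm U \<nu>)"
  using group_ultraproduct bi_invariant_ultraproduct_norm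
  by (simp add: bi_invariant_normed_group_def bi_invariant_normed_group_axioms_def)

lemma carrier_Q: "carrier Q = cls ` carrier P"
  unfolding metric_ultraproduct_def by (rule carrier_FactGroup)

lemma cls_closed: "g \<in> carrier P \<Longrightarrow> cls g \<in> carrier Q"
  by (simp add: carrier_Q)

lemma carrier_QE:
  assumes "X \<in> carrier Q"
  obtains g where "g \<in> carrier P" "X = cls g"
  using assms by (auto simp: carrier_Q)

lemma cls_mult: "g \<in> carrier P \<Longrightarrow> h \<in> carrier P \<Longrightarrow> cls g \<otimes>\<^bsub>Q\<^esub> cls h = cls (g \<otimes>\<^bsub>P\<^esub> h)"
  unfolding metric_ultraproduct_def by (simp add: normal.rcos_sum[OF normal_E])

lemma cls_inv: "g \<in> carrier P \<Longrightarrow> inv\<^bsub>Q\<^esub> cls g = cls (inv\<^bsub>P\<^esub> g)"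
  unfolding metric_ultraproduct_def
  by (simp add: normal.inv_FactGroup[OF normal_E] carrier_FactGroup normal.rcos_inv[OF normal_E])

lemma cls_one: "cls \<one>\<^bsub>P\<^esub> = \<one>\<^bsub>Q\<^esub>"
  unfolding metric_ultraproduct_def
  by (simp add: group.coset_mult_one[OF group_P subgroup.subset[OF normal_imp_subgroup[OF normal_E]]])

lemma dist_limit:
  assumes "g \<in> carrier P" "h \<in> carrier P"
  shows "((\<lambda>n. dG n (g n) (h n)) \<longlongrightarrow> dQ (cls g) (cls h)) U"
proof -
  interpret P: group P by (rule group_P)
  show ?thesis
    using ultraproduct_norm_coset[of "inv\<^bsub>P\<^esub> g \<otimes>\<^bsub>P\<^esub> h"] assms
    by (simp add: norm_dist_def cls_mult cls_inv P_mult P_inv)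
qed

text \<open>Strict bounds in the quotient descend to almost all coordinates, whereas only non-strict
  bounds come back, through \<open>dist_leI\<close> and \<open>dist_geI\<close>.\<close>

lemma eventually_dist_less:
  assumes "g \<in> carrier P" "h \<in> carrier P" "dQ (cls g) (cls h) < e"
  shows "\<forall>\<^sub>F n in U. dG n (g n) (h n) < e"
  using order_tendstoD(2)[OF dist_limit[OF assms(1,2)] assms(3)] .

lemma dist_leI:
  assumes "g \<in> carrier P" "h \<in> carrier P" "\<forall>\<^sub>F n in U. dG n (g n) (h n) \<le> e"
  shows "dQ (cls g) (cls h) \<le> e"
  using tendsto_upperbound[OF dist_limit[OF assms(1,2)] assms(3) U_nontriv] .

lemma dist_geI:
  assumes "g \<in> carrier P" "h \<in> carrier P" "\<forall>\<^sub>F n in U. e \<le> dG n (g n) (h n)"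
  shows "e \<le> dQ (cls g) (cls h)"
  using tendsto_lowerbound[OF dist_limit[OF assms(1,2)] assms(3) U_nontriv] .

lemma cls_eqI:
  assumes "g \<in> carrier P" "h \<in> carrier P" "dQ (cls g) (cls h) = 0"
  shows "cls g = cls h"
proof -
  interpret Q: bi_invariant_normed_group Q "ultraproduct_norm U \<nu>" by (rule normed_Q)
  have "inv\<^bsub>Q\<^esub> cls g \<otimes>\<^bsub>Q\<^esub> cls h = \<one>\<^bsub>Q\<^esub>"
    using assms bi_invariant_normD(5)[OF Q.bi_invariant_norm] cls_closed by (simp add: norm_dist_def)
  then show ?thesis
    using assms(1,2) cls_closed Q.inv_equality Q.inv_inv by (metis Q.inv_closed)
qed

text \<open>Representatives need to be right only on a U-large set, so arbitrary values may be used
  elsewhere.\<close>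

lemma cls_cong:
  assumes "g \<in> carrier P" "h \<in> carrier P" "\<forall>\<^sub>F n in U. g n = h n"
  shows "cls g = cls h"
proof (rule cls_eqI[OF assms(1,2)])
  interpret Q: bi_invariant_normed_group Q "ultraproduct_norm U \<nu>" by (rule normed_Q)
  have "\<forall>\<^sub>F n in U. dG n (g n) (h n) \<le> 0"
    using assms(3)
  proof eventually_elim
    case (elim n)
    then show ?case
      using bi_invariant_normed_group.dist_refl[OF normed_G P_memD[OF assms(2)], of n] by simp
  qed
  then have "dQ (cls g) (cls h) \<le> 0" by (rule dist_leI[OF assms(1,2)])
  then show "dQ (cls g) (cls h) = 0"
    using Q.dist_nonneg[OF cls_closed[OF assms(1)] cls_closed[OF assms(2)]] by simp
qed

text \<open>Primality of U decides, uniformly on a large set, whether x or its inverse is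
  conjugated; the conjugators are then chosen coordinatewise.\<close>

lemma conj_class_sym_ultraproductI:
  assumes x: "x \<in> carrier P" and k: "k \<in> carrier P"
    and ev: "\<forall>\<^sub>F n in U. k n \<in> conj_class_sym (G n) (x n)"
  shows "cls k \<in> conj_class_sym Q (cls x)"
proof -
  interpret P: group P by (rule group_P)
  let ?A = "\<lambda>u n. \<exists>h\<in>carrier (G n). k n = h \<otimes>\<^bsub>G n\<^esub> u n \<otimes>\<^bsub>G n\<^esub> inv\<^bsub>G n\<^esub> h"
  have main: "\<exists>h\<in>carrier P. cls k = cls h \<otimes>\<^bsub>Q\<^esub> cls u \<otimes>\<^bsub>Q\<^esub> inv\<^bsub>Q\<^esub> (cls h)"
    if u: "u \<in> carrier P" and A: "\<forall>\<^sub>F n in U. ?A u n" for u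
  proof -
    \<comment> \<open>The implication makes the choice total: where no conjugator exists, any group
      element serves.\<close>
    have "\<exists>h\<in>carrier (G n). ?A u n \<longrightarrow> k n = h \<otimes>\<^bsub>G n\<^esub> u n \<otimes>\<^bsub>G n\<^esub> inv\<^bsub>G n\<^esub> h" for n
      using P_memD[OF u] by blast
    then obtain h where h: "\<And>n. h n \<in> carrier (G n)"
      "\<And>n. ?A u n \<Longrightarrow> k n = h n \<otimes>\<^bsub>G n\<^esub> u n \<otimes>\<^bsub>G n\<^esub> inv\<^bsub>G n\<^esub> (h n)"
      by metis
    have hP: "h \<in> carrier P" by (rule P_memI) (rule h)
    have "cls k = cls (h \<otimes>\<^bsub>P\<^esub> u \<otimes>\<^bsub>P\<^esub> inv\<^bsub>P\<^esub> h)"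
    proof (rule cls_cong)
      show "\<forall>\<^sub>F n in U. k n = (h \<otimes>\<^bsub>P\<^esub> u \<otimes>\<^bsub>P\<^esub> inv\<^bsub>P\<^esub> h) n"
        using A
      proof eventually_elim
        case (elim n)
        then show ?case using h(2)[of n] by (simp add: P_mult P_inv[OF hP])
      qed
    qed (use k u hP in simp_all)
    then show ?thesis using hP u by (intro bexI[of _ h]) (simp_all add: cls_mult cls_inv)
  qed
  have "\<forall>\<^sub>F n in U. ?A x n \<or> ?A (inv\<^bsub>P\<^esub> x) n"
    using ev by (rule eventually_mono) (auto simp: conj_class_sym_def P_inv[OF x])
  then have "(\<forall>\<^sub>F n in U. ?A x n) \<or> (\<forall>\<^sub>F n in U. ?A (inv\<^bsub>P\<^esub> x) n)" by (rule ultrafilter_disj[OF U])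
  then obtain u where u: "u \<in> {x, inv\<^bsub>P\<^esub> x}" "\<forall>\<^sub>F n in U. ?A u n" by blast
  then obtain h where "h \<in> carrier P" "cls k = cls h \<otimes>\<^bsub>Q\<^esub> cls u \<otimes>\<^bsub>Q\<^esub> inv\<^bsub>Q\<^esub> (cls h)"
    using main[of u] x by blast
  moreover have "cls u \<in> {cls x, inv\<^bsub>Q\<^esub> (cls x)}" using u x by (auto simp: cls_inv)
  ultimately show ?thesis using cls_closed unfolding conj_class_sym_def by blast
qed

text \<open>N bounds the number of factors in all coordinates at once, so finitely many uses of
  primality split the products into factors that are sequences. With
  \<open>conj_products_ultraproductE\<close> this identifies C_N in the ultraproduct with the image
  of the coordinatewise C_N.\<close>

lemma conj_products_ultraproductI:
  assumes x: "x \<in> carrier P"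
  shows "c \<in> carrier P \<Longrightarrow> \<forall>\<^sub>F n in U. c n \<in> conj_products N (x n) (G n) \<Longrightarrow>
    cls c \<in> conj_products N (cls x) Q"
proof (induction N arbitrary: c)
  case 0
  have "cls c = cls \<one>\<^bsub>P\<^esub>"
    using 0 by (intro cls_cong) (simp_all add: group.conj_products_0[OF grp] P_one group.is_monoid[OF group_P] monoid.one_closed)
  then show ?case by (simp add: group.conj_products_0[OF group_ultraproduct] cls_one)
next
  case (Suc N)
  interpret P: group P by (rule group_P)
  let ?A = "\<lambda>n k e. k \<in> conj_class_sym (G n) (x n) \<and> e \<in> conj_products N (x n) (G n) \<and> c n = k \<otimes>\<^bsub>G n\<^esub> e"
  have "\<forall>\<^sub>F n in U. c n = \<one>\<^bsub>G n\<^esub> \<or> (\<exists>k e. ?A n k e)"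
    using Suc.prems(2) by (rule eventually_mono) (auto simp: group.conj_products_Suc[OF grp])
  from ultrafilter_disj[OF U this]
  consider "\<forall>\<^sub>F n in U. c n = \<one>\<^bsub>G n\<^esub>" | "\<forall>\<^sub>F n in U. \<exists>k e. ?A n k e"
    by blast
  then show ?case
  proof cases
    case 1
    then have "cls c = cls \<one>\<^bsub>P\<^esub>" using Suc.prems(1) by (intro cls_cong) (simp_all add: P_one)
    then show ?thesis by (simp add: cls_one group.one_in_conj_products[OF group_ultraproduct])
  next
    case 2
    have "\<exists>k\<in>carrier (G n). \<exists>e\<in>carrier (G n). (\<exists>k e. ?A n k e) \<longrightarrow> ?A n k e" for n
    proof (cases "\<exists>k e. ?A n k e")
      case True
      then show ?thesis
        using group.conj_class_sym_closed[OF grp P_memD[OF x]]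
          group.conj_products_closed[OF grp P_memD[OF x]] by blast
    qed (use P_memD[OF x] in blast)
    then obtain k e where ke: "\<And>n. k n \<in> carrier (G n)" "\<And>n. e n \<in> carrier (G n)"
      "\<And>n. \<exists>k e. ?A n k e \<Longrightarrow> ?A n (k n) (e n)" by metis
    have P: "k \<in> carrier P" "e \<in> carrier P" by (rule P_memI, rule ke)+
    have ev: "\<forall>\<^sub>F n in U. ?A n (k n) (e n)" using 2 ke(3) by (rule eventually_mono)
    have "cls c = cls (k \<otimes>\<^bsub>P\<^esub> e)"
      using ev P Suc.prems(1) by (intro cls_cong) (auto simp: P_mult elim: eventually_mono)
    moreover have "cls k \<in> conj_class_sym Q (cls x)"
      using ev by (intro conj_class_sym_ultraproductI[OF x P(1)]) (auto elim: eventually_mono)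
    moreover have "cls e \<in> conj_products N (cls x) Q"
      using ev by (intro Suc.IH[OF P(2)]) (auto elim: eventually_mono)
    ultimately show ?thesis
      using P by (auto simp: group.conj_products_Suc[OF group_ultraproduct] cls_mult[symmetric])
  qed
qed

text \<open>Lifting the conjugators and keeping one sign per factor yields a representative that is
  a product of conjugates in every coordinate, not only in almost every one.\<close>

lemma conj_products_ultraproductE:
  assumes x: "x \<in> carrier P"
  shows "X \<in> conj_products N (cls x) Q \<Longrightarrow>
    \<exists>c\<in>carrier P. X = cls c \<and> (\<forall>n. c n \<in> conj_products N (x n) (G n))"
proof (induction N arbitrary: X)
  case 0
  interpret P: group P by (rule group_P)
  have "X = cls \<one>\<^bsub>P\<^esub>" using 0 by (simp only: cls_one group.conj_products_0[OF group_ultraproduct] singleton_iff)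
  moreover have "\<one>\<^bsub>P\<^esub> n \<in> conj_products 0 (x n) (G n)" for n
    by (simp add: P_one group.one_in_conj_products[OF grp])
  ultimately show ?case using P.one_closed by blast
next
  case (Suc N)
  interpret P: group P by (rule group_P)
  from Suc.prems consider "X = \<one>\<^bsub>Q\<^esub>"
    | K C where "X = K \<otimes>\<^bsub>Q\<^esub> C" "K \<in> conj_class_sym Q (cls x)" "C \<in> conj_products N (cls x) Q"
    by (auto simp: group.conj_products_Suc[OF group_ultraproduct])
  then show ?case
  proof cases
    case 1
    then have "X = cls \<one>\<^bsub>P\<^esub>" by (simp only: cls_one)
    moreover have "\<one>\<^bsub>P\<^esub> n \<in> conj_products (Suc N) (x n) (G n)" for n
      by (simp add: P_one group.one_in_conj_products[OF grp])
    ultimately show ?thesis using P.one_closed by blast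
  next
    case 2
    obtain c where c: "c \<in> carrier P" "C = cls c" "\<And>n. c n \<in> conj_products N (x n) (G n)"
      using Suc.IH[OF 2(3)] by blast
    obtain H u where H: "H \<in> carrier Q" "u \<in> {x, inv\<^bsub>P\<^esub> x}" "K = H \<otimes>\<^bsub>Q\<^esub> cls u \<otimes>\<^bsub>Q\<^esub> inv\<^bsub>Q\<^esub> H"
      using 2(2) x by (auto simp: conj_class_sym_def cls_inv)
    obtain h where h: "h \<in> carrier P" "H = cls h" using carrier_QE[OF H(1)] .
    let ?k = "h \<otimes>\<^bsub>P\<^esub> u \<otimes>\<^bsub>P\<^esub> inv\<^bsub>P\<^esub> h"
    have u: "u \<in> carrier P" using H(2) x by auto
    have "u n \<in> {x n, inv\<^bsub>G n\<^esub> (x n)}" for n using H(2) x by (auto simp: P_inv)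
    then have k: "?k n \<in> conj_class_sym (G n) (x n)" for n
      using P_memD[OF h(1)] unfolding conj_class_sym_def by (auto simp: P_mult P_inv[OF h(1)])
    have "X = cls (?k \<otimes>\<^bsub>P\<^esub> c)"
      using 2(1) H(3) h c u by (simp add: cls_mult cls_inv)
    moreover have "(?k \<otimes>\<^bsub>P\<^esub> c) n \<in> conj_products (Suc N) (x n) (G n)" for n
      using k[of n] c(3)[of n] by (auto simp: group.conj_products_Suc[OF grp] P_mult[of ?k])
    ultimately show ?thesis using h c u by (intro bexI[of _ "?k \<otimes>\<^bsub>P\<^esub> c"]) simp_all
  qed
qed

end

section \<open>Consequences of saturation: closedness, completeness and uniform density\<close>

locale saturated_norm_ultraproduct = bounded_norm_ultraproduct U G \<nu> B
  for U :: "nat filter" and G :: "nat \<Rightarrow> ('a, 'b) monoid_scheme" and \<nu> B +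
  assumes non_principal: "non_principal U"
begin

text \<open>Saturation solves the conditions \<open>dG n c (y n) < 1 / (real k + 1)\<close> for all
  k by one sequence of products of conjugates; its class is at distance 0 from Y.\<close>

lemma conj_products_ultraproduct_closed:
  assumes "X \<in> carrier Q" "Y \<in> carrier Q"
    and close: "\<And>e. e > 0 \<Longrightarrow> \<exists>C\<in>conj_products N X Q. dQ C Y < e"
  shows "Y \<in> conj_products N X Q"
proof -
  interpret Q: bi_invariant_normed_group Q "ultraproduct_norm U \<nu>" by (rule normed_Q)
  obtain x where x: "x \<in> carrier P" "X = cls x" using carrier_QE[OF assms(1)] .
  obtain y where y: "y \<in> carrier P" "Y = cls y" using carrier_QE[OF assms(2)] .
  obtain c where c: "\<And>n. c n \<in> conj_products N (x n) (G n)"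
    "\<And>k. \<forall>\<^sub>F n in U. dG n (c n) (y n) < 1 / (real k + 1)"
  proof (rule countable_saturation[OF U non_principal,
        where A = "\<lambda>n. conj_products N (x n) (G n)" and \<phi> = "\<lambda>k n c. dG n c (y n) < 1 / (real k + 1)"])
    show "conj_products N (x n) (G n) \<noteq> {}" for n
      using group.one_in_conj_products[OF grp] by blast
    fix k
    obtain C where C: "C \<in> conj_products N X Q" "dQ C Y < 1 / (real k + 1)"
      using close[of "1 / (real k + 1)"] by auto
    obtain c where c: "c \<in> carrier P" "C = cls c" "\<And>n. c n \<in> conj_products N (x n) (G n)"
      using conj_products_ultraproductE[OF x(1) C(1)[unfolded x(2)]] by blast
    have "\<forall>\<^sub>F n in U. dG n (c n) (y n) < 1 / (real k + 1)"
      using eventually_dist_less[OF c(1) y(1)] C(2) c(2) y(2) by simp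
    then show "\<forall>\<^sub>F n in U. \<exists>c\<in>conj_products N (x n) (G n). \<forall>j\<le>k. dG n c (y n) < 1 / (real j + 1)"
    proof eventually_elim
      case (elim n)
      \<comment> \<open>The approximation found for k serves all smaller indices, whose bounds are
        weaker.\<close>
      have "dG n (c n) (y n) < 1 / (real j + 1)" if "j \<le> k" for j
        by (rule order_less_le_trans[OF elim]) (use that in \<open>simp add: frac_le\<close>)
      then show ?case using c(3) by blast
    qed
  qed (rule that)
  have cP: "c \<in> carrier P"
    by (rule P_memI[OF subsetD[OF group.conj_products_closed[OF grp P_memD[OF x(1)]] c(1)]])
  have lim: "dQ (cls c) (cls y) \<le> 1 / (real k + 1)" for k
    by (rule dist_leI[OF cP y(1) eventually_mono[OF c(2)[of k]]]) simp
  have "dQ (cls c) (cls y) \<le> 0"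
  proof (rule field_le_epsilon)
    fix a :: real assume "a > 0"
    then obtain k where "1 / real (Suc k) < a" by (rule nat_approx_posE)
    then show "dQ (cls c) (cls y) \<le> 0 + a" using lim[of k] by (simp add: add.commute)
  qed
  then have "cls c = cls y"
    using Q.dist_nonneg[OF cls_closed[OF cP] cls_closed[OF y(1)]] by (intro cls_eqI[OF cP y(1)]) simp
  moreover have "cls c \<in> conj_products N (cls x) Q"
    by (rule conj_products_ultraproductI[OF x(1) cP]) (simp add: c(1))
  ultimately show ?thesis using x y by simp
qed

text \<open>The centre with index k meets the conditions up to k, so saturation gives a common point
  of all the balls, whatever their radii.\<close>

lemma nested_balls:
  fixes e :: "nat \<Rightarrow> real"
  assumes "\<And>k. F k \<in> carrier Q" "\<And>j k. j \<le> k \<Longrightarrow> dQ (F k) (F j) < e j"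
  shows "\<exists>X\<in>carrier Q. \<forall>j. dQ X (F j) \<le> e j"
proof -
  have "\<forall>k. \<exists>g. g \<in> carrier P \<and> F k = cls g" using carrier_QE[OF assms(1)] by metis
  then obtain f where f: "\<And>k. f k \<in> carrier P" "\<And>k. F k = cls (f k)" by metis
  obtain x where x: "\<And>n. x n \<in> carrier (G n)" "\<And>j. \<forall>\<^sub>F n in U. dG n (x n) (f j n) < e j"
  proof (rule countable_saturation[OF U non_principal,
        where A = "\<lambda>n. carrier (G n)" and \<phi> = "\<lambda>j n x. dG n x (f j n) < e j"])
    show "carrier (G n) \<noteq> {}" for n using P_memD[OF f(1)[of 0]] by blast
    fix k
    have "\<forall>\<^sub>F n in U. \<forall>j\<in>{..k}. dG n (f k n) (f j n) < e j"
      using assms(2) f by (intro eventually_ball_finite ballI eventually_dist_less) auto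
    then show "\<forall>\<^sub>F n in U. \<exists>x\<in>carrier (G n). \<forall>j\<le>k. dG n x (f j n) < e j"
      by (rule eventually_mono) (use P_memD[OF f(1)[of k]] in auto)
  qed (rule that)
  have xP: "x \<in> carrier P" by (rule P_memI) (rule x)
  have "dQ (cls x) (F j) \<le> e j" for j
    unfolding f(2) by (rule dist_leI[OF xP f(1) eventually_mono[OF x(2)[of j]]]) simp
  then show ?thesis using cls_closed[OF xP] by blast
qed

text \<open>Simplicity gives an N for each pair separately. If no M worked for all pairs, saturation
  would glue the counterexamples, one for each M, into a single pair violating simplicity.\<close>

lemma conj_products_dense:
  assumes simple: "abstractly_simple Q" and r: "r > 0" and e: "e > 0"
  shows "\<exists>M. \<forall>X\<in>carrier Q. ultraproduct_norm U \<nu> X > r \<longrightarrow>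
    (\<forall>Y\<in>carrier Q. \<exists>C\<in>conj_products M X Q. dQ C Y < e)"
proof (rule ccontr)
  interpret Q: bi_invariant_normed_group Q "ultraproduct_norm U \<nu>" by (rule normed_Q)
  assume "\<not> ?thesis"
  then have "\<forall>M. \<exists>x y. x \<in> carrier P \<and> y \<in> carrier P \<and> ultraproduct_norm U \<nu> (cls x) > r \<and>
    (\<forall>C\<in>conj_products M (cls x) Q. dQ C (cls y) \<ge> e)"
    by (force simp: carrier_Q not_less)
  then obtain f g where fg: "\<And>M. f M \<in> carrier P" "\<And>M. g M \<in> carrier P"
    "\<And>M. ultraproduct_norm U \<nu> (cls (f M)) > r"
    "\<And>M C. C \<in> conj_products M (cls (f M)) Q \<Longrightarrow> dQ C (cls (g M)) \<ge> e"
    by metis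
  \<comment> \<open>Halving e leaves room for limits: products within e / 2 on a large set would
    give one within e / 2 < e in the quotient, and in the end distances > e / 2 still have a
    positive limit.\<close>
  define bad where "bad = (\<lambda>M n (x, y). \<nu> n x > r \<and> (\<forall>c\<in>conj_products M x (G n). dG n c y > e / 2))"
  have ev: "\<forall>\<^sub>F n in U. bad M n (f M n, g M n)" for M
  proof -
    have "\<forall>\<^sub>F n in U. \<nu> n (f M n) > r"
      by (rule order_tendstoD(1)[OF ultraproduct_norm_coset[OF fg(1)] fg(3)])
    moreover have "\<forall>\<^sub>F n in U. \<not> (\<exists>c\<in>conj_products M (f M n) (G n). dG n c (g M n) \<le> e / 2)"
    proof (rule ccontr)
      let ?D = "\<lambda>n c. c \<in> conj_products M (f M n) (G n) \<and> dG n c (g M n) \<le> e / 2"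
      assume "\<not> (\<forall>\<^sub>F n in U. \<not> (\<exists>c\<in>conj_products M (f M n) (G n). dG n c (g M n) \<le> e / 2))"
      moreover have "(\<forall>\<^sub>F n in U. \<exists>c\<in>conj_products M (f M n) (G n). dG n c (g M n) \<le> e / 2) \<or>
          (\<forall>\<^sub>F n in U. \<not> (\<exists>c\<in>conj_products M (f M n) (G n). dG n c (g M n) \<le> e / 2))"
        by (rule ultrafilter_disj[OF U], rule always_eventually) blast
      ultimately have *: "\<forall>\<^sub>F n in U. \<exists>c. ?D n c" unfolding Bex_def by blast
      have "\<exists>c\<in>carrier (G n). (\<exists>c. ?D n c) \<longrightarrow> ?D n c" for n
      proof (cases "\<exists>c. ?D n c")
        case True
        then show ?thesis using group.conj_products_closed[OF grp P_memD[OF fg(1)]] by blast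
      qed (use P_memD[OF fg(1)] in blast)
      then obtain c where c: "\<And>n. c n \<in> carrier (G n)" "\<And>n. \<exists>c. ?D n c \<Longrightarrow> ?D n (c n)" by metis
      have cP: "c \<in> carrier P" by (rule P_memI) (rule c)
      have evD: "\<forall>\<^sub>F n in U. ?D n (c n)" using * c(2) by (rule eventually_mono)
      have "cls c \<in> conj_products M (cls (f M)) Q"
        by (rule conj_products_ultraproductI[OF fg(1) cP eventually_mono[OF evD]]) simp
      moreover have "dQ (cls c) (cls (g M)) \<le> e / 2"
        by (rule dist_leI[OF cP fg(2) eventually_mono[OF evD]]) simp
      ultimately show False using fg(4)[of "cls c" M] e by simp
    qed
    ultimately show ?thesis by eventually_elim (auto simp: bad_def not_le)
  qed
  obtain z where z: "\<And>n. z n \<in> carrier (G n) \<times> carrier (G n)" "\<And>M. \<forall>\<^sub>F n in U. bad M n (z n)"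
  proof (rule countable_saturation[OF U non_principal,
        where A = "\<lambda>n. carrier (G n) \<times> carrier (G n)" and \<phi> = bad])
    show "carrier (G n) \<times> carrier (G n) \<noteq> {}" for n using P_memD[OF fg(1)[of 0]] by blast
    show "\<forall>\<^sub>F n in U. \<exists>z\<in>carrier (G n) \<times> carrier (G n). \<forall>j\<le>k. bad j n z" for k
      using ev[of k]
    proof eventually_elim
      case (elim n)
      \<comment> \<open>The counterexample for k is one for every smaller index, because the sets of
        products grow with the index.\<close>
      then have "bad j n (f k n, g k n)" if "j \<le> k" for j
        using group.conj_products_mono[OF grp that] unfolding bad_def by fast
      then show ?case using P_memD[OF fg(1)[of k]] P_memD[OF fg(2)[of k]] by blast
    qed
  qed (rule that)
  define x y where "x = (\<lambda>n. fst (z n))" and "y = (\<lambda>n. snd (z n))"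
  have xy: "x n \<in> carrier (G n)" "y n \<in> carrier (G n)" for n
    using z(1)[of n] by (auto simp: x_def y_def)
  have bad: "\<forall>\<^sub>F n in U. bad M n (x n, y n)" for M using z(2) by (simp add: x_def y_def)
  have xP: "x \<in> carrier P" and yP: "y \<in> carrier P" using xy by (auto intro: P_memI)
  have "\<forall>\<^sub>F n in U. r \<le> \<nu> n (x n)"
    using bad[of 0] by (rule eventually_mono) (simp add: bad_def)
  then have "r \<le> ultraproduct_norm U \<nu> (cls x)"
    using tendsto_lowerbound[OF ultraproduct_norm_coset[OF xP]] U_nontriv by blast
  then have "cls x \<noteq> \<one>\<^bsub>Q\<^esub>" using r Q.norm_one by auto
  \<comment> \<open>The pair is now fixed, so simplicity yields one N, while \<open>bad N\<close>
    keeps every product of at most N conjugates away from y on a large set.\<close>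
  then obtain N where "cls y \<in> conj_products N (cls x) Q"
    using Q.abstractly_simple_conj_products[OF simple cls_closed[OF xP] _ cls_closed[OF yP]] by blast
  then obtain c where c: "c \<in> carrier P" "cls y = cls c" "\<And>n. c n \<in> conj_products N (x n) (G n)"
    using conj_products_ultraproductE[OF xP] by blast
  have "\<forall>\<^sub>F n in U. e / 2 \<le> dG n (c n) (y n)"
    using bad[of N] by (rule eventually_mono) (use c(3) in \<open>force simp: bad_def\<close>)
  then have "e / 2 \<le> dQ (cls c) (cls y)" by (rule dist_geI[OF c(1) yP])
  then show False using Q.dist_refl[OF cls_closed[OF yP]] c(2) e by simp
qed

theorem metrically_uniformly_simple_ultraproduct:
  assumes "abstractly_simple Q"
  shows "metrically_uniformly_simple Q (ultraproduct_norm U \<nu>)"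
  by (rule bi_invariant_normed_group.metrically_uniformly_simple_if_dense[OF normed_Q assms])
    (fact conj_products_ultraproduct_closed nested_balls conj_products_dense[OF assms])+

end

theorem corollary8p14:
  fixes G :: "nat \<Rightarrow> ('a, 'b) monoid_scheme"
    and \<nu> \<nu>' :: "nat \<Rightarrow> 'a \<Rightarrow> real"
    and U :: "nat filter"
  assumes "\<And>n. group (G n)"
    and "\<And>n. bi_invariant_norm (G n) (\<nu> n)"
    and "\<And>n. bi_invariant_norm (G n) (\<nu>' n)"
    and "\<And>n g. g \<in> carrier (G n) \<Longrightarrow> \<nu> n g \<le> 1"
    and "\<And>n g. g \<in> carrier (G n) \<Longrightarrow> \<nu>' n g \<le> 1"
    and "ultrafilter U" and "non_principal U"
    and "metrically_uniformly_simple_family G \<nu>"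
    and "abstractly_simple (metric_ultraproduct U G \<nu>')"
  shows "metrically_uniformly_simple (metric_ultraproduct U G \<nu>') (ultraproduct_norm U \<nu>')"
proof -
  interpret saturated_norm_ultraproduct U G \<nu>' 1
    by (intro saturated_norm_ultraproduct.intro bounded_norm_ultraproduct.intro
      saturated_norm_ultraproduct_axioms.intro) (fact assms)+
  show ?thesis by (rule metrically_uniformly_simple_ultraproduct) fact
qed

end
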